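(* Let $D\subset\mathbb{R}$, $\phi_0\in\mathbb{R}\setminus D$, and let $\pi_2$ be a probability distribution on $\mathbb{R}$ with $\pi_2(D)=1$. Consider testing problems with $N$ hypotheses in which it is fixed (non-random) which of the $H_0^j$ are true and which are false, $\sigma_1,\dots,\sigma_N>0$ are fixed, $\phi_j=\phi_0$ for each $j$ with $H_0^j$ true, and the $\phi_j$ with $H_0^j$ false are i.i.d. with distribution $\pi_2$. Let $N_1$ be the number of $j$ with $H_0^j$ false. For measurable $C\subset\mathbb{R}^T$ let $$\mathrm{ETP}=\sum_{\{j\mid H_0^j\text{ is false}\}}P_{\phi_j,\sigma_j}({\bf y}_j\in C),\qquad \mathrm{EFP}=\sum_{\{j\mid H_0^j\text{ is true}\}}P_{\phi_0,\sigma_j}({\bf y}_j\in C),$$ $$\mathrm{BETP}=\frac1{N_1}\sum_{\{j\mid H_0^j\text{ is false}\}}\int P_{\phi,\sigma_j}({\bf y}\in C)\,d\pi_2(\phi),\qquad \mathrm{BEFP}=\frac1{N-N_1}\sum_{\{j\mid H_0^j\text{ is true}\}}P_{\phi_0,\sigma_j}({\bf y}\in C).$$ (1) For every fixed measurable $C$, along any sequence of such problems with $N_1\to\infty$ and $N-N_1\to\infty$, $$\frac{\mathrm{ETP}}{N_1}-\mathrm{BETP}\longrightarrow0\quad\text{and}\quad\frac{\mathrm{EFP}}{N-N_1}-\mathrm{BEFP}\longrightarrow0\quad\text{in probability}.$$ (2) Fix one such problem with $1\le N_1\le N-1$ and let $\alpha\in[0,1]$. The MAP test rejects $H_0^j$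 if and only if ${\bf y}_j\in C^*$, where $$C^*=\left\{{\bf y}\in\mathbb{R}^T\ \middle|\ \frac{\sum_{\{j\mid H_0^j\text{ is false}\}}\int f({\bf y}\mid\phi,\sigma_j)\,d\pi_2(\phi)}{\sum_{\{j\mid H_0^j\text{ is true}\}}f({\bf y}\mid\phi_0,\sigma_j)}>\mathrm{crit}\right\}$$ and the real number $\mathrm{crit}$ is chosen so that $\mathrm{BEFP}=\alpha$ for $C=C^*$; that is, for such $\mathrm{crit}$, $C=C^*$ maximizes $\mathrm{BETP}$ among all measurable $C\subset\mathbb{R}^T$ with $\mathrm{BEFP}\le\alpha$.
   Context: For parameters $\phi\in\mathbb{R}$, $\sigma>0$, $f(\cdot\mid\phi,\sigma)$ is a probability density on $\mathbb{R}^T$, jointly measurable in its arguments, and $P_{\phi,\sigma}({\bf y}\in C)=\int_{C}f({\bf y}\mid\phi,\sigma)\,d{\bf y}$. The $j$-th observation ${\bf y}_j$ has density $f(\cdot\mid\phi_j,\sigma_j)$ given its parameters. The hypotheses are $H_0^j:\phi_j=\phi_0$ versus $H_1^j:\phi_j\in D$, $j=1,\dots,N$; procedures considered reject $H_0^j$ if and only if ${\bf y}_j\in C$ with $C$ not depending on $j$. ETP and EFP (expected numbers of true and false positives for given parameters) are random through the $\phi_j$. The MAP (maximum average power) test at level $\alpha$ is the test maximizing $\mathrm{BETP}$ among all tests with $\mathrm{BEFP}\le\alpha$. Convention for ratios: $a/0=+\infty$ for $a>0$ and $0/0=0$. *)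

theory Defs
  imports "HOL-Probability.Probability"
begin

text \<open>
  The argument order is \<open>f y \<phi> \<sigma>\<close> for \<open>f(y | \<phi>, \<sigma>)\<close>. Nothing is required of \<open>f\<close> at \<open>\<sigma> \<le> 0\<close>.
\<close>

definition density_family :: "(real ^ 'T \<Rightarrow> real \<Rightarrow> real \<Rightarrow> real) \<Rightarrow> bool" where
  "density_family f \<longleftrightarrow>
     (\<lambda>(y, \<phi>, \<sigma>). f y \<phi> \<sigma>)
       \<in> borel_measurable (borel \<Otimes>\<^sub>M borel \<Otimes>\<^sub>M restrict_space borel {0<..}) \<and>
     (\<forall>\<phi> \<sigma>. \<sigma> > 0 \<longrightarrow>
        (\<forall>y. f y \<phi> \<sigma> \<ge> 0) \<and> (\<integral>\<^sup>+ y. ennreal (f y \<phi> \<sigma>) \<partial>lborel) = 1)"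

definition reject_prob ::
    "(real ^ 'T \<Rightarrow> real \<Rightarrow> real \<Rightarrow> real) \<Rightarrow> real \<Rightarrow> real \<Rightarrow> (real ^ 'T) set \<Rightarrow> real" where
  "reject_prob f \<phi> \<sigma> C = (LINT y:C|lborel. f y \<phi> \<sigma>)"

text \<open>
  The hypotheses are indexed by \<open>{1..N}\<close>; \<open>F\<close> is the set of indices of the false null hypotheses,
  so that \<open>N\<^sub>1 = card F\<close> and \<open>{1..N} - F\<close> indexes the true ones.
\<close>

definition testing_problem :: "nat \<Rightarrow> nat set \<Rightarrow> (nat \<Rightarrow> real) \<Rightarrow> bool" where
  "testing_problem N F \<sigma> \<longleftrightarrow> F \<subseteq> {1..N} \<and> (\<forall>j\<in>{1..N}. \<sigma> j > 0)"

definition random_parameters ::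
    "real \<Rightarrow> real measure \<Rightarrow> nat \<Rightarrow> nat set \<Rightarrow> 'w measure \<Rightarrow> (nat \<Rightarrow> 'w \<Rightarrow> real) \<Rightarrow> bool" where
  "random_parameters \<phi>\<^sub>0 \<pi>\<^sub>2 N F M \<phi> \<longleftrightarrow>
     prob_space M \<and>
     (\<forall>j\<in>{1..N} - F. \<forall>\<omega>\<in>space M. \<phi> j \<omega> = \<phi>\<^sub>0) \<and>
     prob_space.indep_vars M (\<lambda>_. borel) \<phi> F \<and>
     (\<forall>j\<in>F. distr M borel (\<phi> j) = \<pi>\<^sub>2)"

definition ETP ::
    "(real ^ 'T \<Rightarrow> real \<Rightarrow> real \<Rightarrow> real) \<Rightarrow> nat set \<Rightarrow> (nat \<Rightarrow> real) \<Rightarrow> (nat \<Rightarrow> real) \<Rightarrow>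
     (real ^ 'T) set \<Rightarrow> real" where
  "ETP f F \<sigma> \<phi> C = (\<Sum>j\<in>F. reject_prob f (\<phi> j) (\<sigma> j) C)"

definition EFP ::
    "(real ^ 'T \<Rightarrow> real \<Rightarrow> real \<Rightarrow> real) \<Rightarrow> real \<Rightarrow> nat \<Rightarrow> nat set \<Rightarrow> (nat \<Rightarrow> real) \<Rightarrow>
     (real ^ 'T) set \<Rightarrow> real" where
  "EFP f \<phi>\<^sub>0 N F \<sigma> C = (\<Sum>j\<in>{1..N} - F. reject_prob f \<phi>\<^sub>0 (\<sigma> j) C)"

definition BETP ::
    "(real ^ 'T \<Rightarrow> real \<Rightarrow> real \<Rightarrow> real) \<Rightarrow> real measure \<Rightarrow> nat set \<Rightarrow> (nat \<Rightarrow> real) \<Rightarrow>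
     (real ^ 'T) set \<Rightarrow> real" where
  "BETP f \<pi>\<^sub>2 F \<sigma> C =
     1 / real (card F) * (\<Sum>j\<in>F. LINT \<phi>|\<pi>\<^sub>2. reject_prob f \<phi> (\<sigma> j) C)"

definition BEFP ::
    "(real ^ 'T \<Rightarrow> real \<Rightarrow> real \<Rightarrow> real) \<Rightarrow> real \<Rightarrow> nat \<Rightarrow> nat set \<Rightarrow> (nat \<Rightarrow> real) \<Rightarrow>
     (real ^ 'T) set \<Rightarrow> real" where
  "BEFP f \<phi>\<^sub>0 N F \<sigma> C =
     1 / real (N - card F) * (\<Sum>j\<in>{1..N} - F. reject_prob f \<phi>\<^sub>0 (\<sigma> j) C)"

text \<open>
  The spaces may differ along the sequence. Measurability is part of the definition because
  \<^const>\<open>measure\<close> is \<open>0\<close> on non-measurable sets.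
\<close>

definition tends_to_zero_in_prob :: "(nat \<Rightarrow> 'w measure) \<Rightarrow> (nat \<Rightarrow> 'w \<Rightarrow> real) \<Rightarrow> bool" where
  "tends_to_zero_in_prob M X \<longleftrightarrow>
     (\<forall>n. X n \<in> borel_measurable (M n)) \<and>
     (\<forall>\<epsilon>>0. (\<lambda>n. measure (M n) {\<omega> \<in> space (M n). \<bar>X n \<omega>\<bar> > \<epsilon>}) \<longlonglongrightarrow> 0)"

definition MAP_test ::
    "(real ^ 'T \<Rightarrow> real \<Rightarrow> real \<Rightarrow> real) \<Rightarrow> real \<Rightarrow> real measure \<Rightarrow> nat \<Rightarrow> nat set \<Rightarrow>
     (nat \<Rightarrow> real) \<Rightarrow> real \<Rightarrow> (real ^ 'T) set \<Rightarrow> bool" where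
  "MAP_test f \<phi>\<^sub>0 \<pi>\<^sub>2 N F \<sigma> \<alpha> C \<longleftrightarrow>
     C \<in> sets borel \<and> BEFP f \<phi>\<^sub>0 N F \<sigma> C \<le> \<alpha> \<and>
     (\<forall>C'\<in>sets borel. BEFP f \<phi>\<^sub>0 N F \<sigma> C' \<le> \<alpha> \<longrightarrow>
        BETP f \<pi>\<^sub>2 F \<sigma> C' \<le> BETP f \<pi>\<^sub>2 F \<sigma> C)"

text \<open>
  The ratio is taken in \<^typ>\<open>ennreal\<close>, where \<open>a / 0 = \<infinity>\<close> for \<open>a > 0\<close> and \<open>0 / 0 = 0\<close>. The numerator
  may be infinite for some \<open>y\<close>; the denominator is always finite. The comparison is made in
  \<^typ>\<open>ereal\<close> because \<open>crit\<close> may be negative.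
\<close>

definition ratio_region ::
    "(real ^ 'T \<Rightarrow> real \<Rightarrow> real \<Rightarrow> real) \<Rightarrow> real \<Rightarrow> real measure \<Rightarrow> nat \<Rightarrow> nat set \<Rightarrow>
     (nat \<Rightarrow> real) \<Rightarrow> real \<Rightarrow> (real ^ 'T) set" where
  "ratio_region f \<phi>\<^sub>0 \<pi>\<^sub>2 N F \<sigma> crit =
     {y. enn2ereal ((\<Sum>j\<in>F. \<integral>\<^sup>+ \<phi>. ennreal (f y \<phi> (\<sigma> j)) \<partial>\<pi>\<^sub>2) /
                    (\<Sum>j\<in>{1..N} - F. ennreal (f y \<phi>\<^sub>0 (\<sigma> j)))) > ereal crit}"

end

theory Submission
  imports Defs
begin

text \<open>
  Given the parameters, \<open>EFP / (N - N\<^sub>1)\<close> is \<open>BEFP\<close> itself, while \<open>ETP\<close> is a sum of \<open>N\<^sub>1\<close> independent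
  \<open>[0,1]\<close>-valued variables with mean \<open>N\<^sub>1 BETP\<close>, so part (1) is Hoeffding's inequality. By Tonelli's
  theorem, \<open>N\<^sub>1 BETP\<close> and \<open>(N - N\<^sub>1) BEFP\<close> are integrals over \<open>C\<close> of the numerator and the denominator
  of the ratio, so part (2) is the Neyman-Pearson lemma for two measures that need not be normalised.
\<close>

section \<open>Clearing denominators; measurability and bounds of rejection probabilities\<close>

text \<open>For \<open>b \<noteq> 0\<close> this is multiplication by a finite positive number. For
  \<open>b = 0\<close> both sides say \<open>0 < a\<close>: the quotient is then
  \<open>\<infinity>\<close>, above the finite \<open>c\<close>, or \<open>0\<close>. So the
  convention for ratios is the one under which the ratio region becomes a linear comparison of
  numerator and denominator.\<close>

lemma less_divide_ennreal:
  fixes a b c :: ennreal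
  assumes "b < top" "c < top"
  shows "c < a / b \<longleftrightarrow> c * b < a"
proof (cases "b = 0")
  case True
  then show ?thesis
    using assms by (cases "a = 0") (auto simp: ennreal_divide_zero zero_less_iff_neq_zero)
next
  case False
  \<comment> \<open>The negated equivalence is proved, because multiplication in
    \<open>ennreal\<close> is monotone for \<open>\<le>\<close> without side conditions.\<close>
  have "a / b \<le> c \<longleftrightarrow> a \<le> c * b"
  proof
    assume "a / b \<le> c"
    then have "a / b * b \<le> c * b" by (intro mult_right_mono) auto
    then show "a \<le> c * b"
      using False assms by (simp add: ennreal_divide_times ennreal_times_divide mult.commute ennreal_mult_divide_eq)
  next
    assume "a \<le> c * b"
    then show "a / b \<le> c"
      using False assms by (intro divide_le_posI_ennreal) (auto simp: mult.commute zero_less_iff_neq_zero)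
  qed
  then show ?thesis by (meson not_le)
qed

lemma borel_measurable_density_family:
  assumes "density_family f" "0 < \<sigma>"
  shows "(\<lambda>(y, \<phi>). f y \<phi> \<sigma>) \<in> borel_measurable (borel \<Otimes>\<^sub>M borel)"
proof -
  \<comment> \<open>Positivity of \<open>\<sigma>\<close> makes it a point of the restricted space,
    so inserting it as third coordinate is a measurable map.\<close>
  have "(\<lambda>(y, \<phi>). (y, \<phi>, \<sigma>)) \<in> borel \<Otimes>\<^sub>M borel \<rightarrow>\<^sub>M borel \<Otimes>\<^sub>M borel \<Otimes>\<^sub>M restrict_space borel {0<..}"
    using \<open>0 < \<sigma>\<close> by (auto intro!: measurable_Pair simp: split_beta' space_restrict_space)
  from measurable_compose[OF this, of "\<lambda>(y, \<phi>, \<sigma>). f y \<phi> \<sigma>" borel]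
  show ?thesis
    using assms by (simp add: density_family_def split_beta')
qed

lemma borel_measurable_density_family_section:
  assumes "density_family f" "0 < \<sigma>"
  shows "(\<lambda>y. f y \<phi> \<sigma>) \<in> borel_measurable borel"
  using measurable_compose[OF _ borel_measurable_density_family[OF assms], of "\<lambda>y. (y, \<phi>)" borel]
  by simp

text \<open>The density integrates to 1, so the integral over \<open>C\<close> is finite and the
  conversion by \<open>enn2real\<close> loses nothing. This moves the probabilities to
  \<open>ennreal\<close>, where sums and integrals can be interchanged without integrability
  conditions.\<close>

lemma ennreal_reject_prob:
  assumes f: "density_family f" "0 < \<sigma>" and C[measurable]: "C \<in> sets borel"
  shows "ennreal (reject_prob f \<phi> \<sigma> C) = (\<integral>\<^sup>+ y. ennreal (f y \<phi> \<sigma>) * indicator C y \<partial>lborel)"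
proof -
  note [measurable] = borel_measurable_density_family_section[OF f]
  have nonneg: "0 \<le> f y \<phi> \<sigma>" for y
    using f by (auto simp: density_family_def)
  have le: "(\<integral>\<^sup>+ y. ennreal (f y \<phi> \<sigma>) * indicator C y \<partial>lborel) \<le> (\<integral>\<^sup>+ y. ennreal (f y \<phi> \<sigma>) \<partial>lborel)"
    by (intro nn_integral_mono) (auto simp: indicator_def)
  also have "\<dots> = 1"
    using f by (auto simp: density_family_def)
  finally have le: "(\<integral>\<^sup>+ y. ennreal (f y \<phi> \<sigma>) * indicator C y \<partial>lborel) < top"
    using le_less_trans by fastforce
  have eq: "ennreal (indicator C y * f y \<phi> \<sigma>) = ennreal (f y \<phi> \<sigma>) * indicator C y" for y
    by (auto simp: indicator_def)
  have "reject_prob f \<phi> \<sigma> C = enn2real (\<integral>\<^sup>+ y. ennreal (f y \<phi> \<sigma>) * indicator C y \<partial>lborel)"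
    unfolding reject_prob_def set_lebesgue_integral_def
    by (subst integral_eq_nn_integral) (auto simp: nonneg eq)
  then show ?thesis
    using le by simp
qed

lemma reject_prob_bounds:
  assumes f: "density_family f" "0 < \<sigma>" and C: "C \<in> sets borel"
  shows "0 \<le> reject_prob f \<phi> \<sigma> C" "reject_prob f \<phi> \<sigma> C \<le> 1"
proof -
  have "0 \<le> f y \<phi> \<sigma>" for y
    using f by (auto simp: density_family_def)
  then show "0 \<le> reject_prob f \<phi> \<sigma> C"
    unfolding reject_prob_def set_lebesgue_integral_def
    by (intro Bochner_Integration.integral_nonneg) auto
  have "ennreal (reject_prob f \<phi> \<sigma> C) \<le> (\<integral>\<^sup>+ y. ennreal (f y \<phi> \<sigma>) \<partial>lborel)"
    unfolding ennreal_reject_prob[OF assms]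
    by (intro nn_integral_mono) (auto simp: indicator_def)
  also have "\<dots> = 1"
    using f by (auto simp: density_family_def)
  finally show "reject_prob f \<phi> \<sigma> C \<le> 1" by simp
qed

lemma borel_measurable_reject_prob:
  assumes f: "density_family f" "0 < \<sigma>" and C[measurable]: "C \<in> sets borel"
  shows "(\<lambda>\<phi>. reject_prob f \<phi> \<sigma> C) \<in> borel_measurable borel"
proof -
  note [measurable] = borel_measurable_density_family[OF f]
  \<comment> \<open>The coordinates are swapped so that the parameter comes first and the
    integration variable second.\<close>
  have "(\<lambda>(\<phi>, y). f y \<phi> \<sigma>) \<in> borel_measurable (borel \<Otimes>\<^sub>M lborel)"
    by measurable
  then show ?thesis
    unfolding reject_prob_def set_lebesgue_integral_def by measurable
qed

section \<open>Concentration of the number of true positives\<close>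

text \<open>The summands are independent but in general not identically distributed, as
  \<open>\<sigma> j\<close> varies with \<open>j\<close>. Hoeffding's inequality needs only their
  range \<open>[0,1]\<close>, and its bound depends on nothing but \<open>\<epsilon>\<close> and
  \<open>card F\<close>; hence it is uniform over changing problems and probability spaces.\<close>

lemma ETP_concentration:
  assumes f: "density_family f" and C: "C \<in> sets borel"
    and tp: "testing_problem N F \<sigma>" and rp: "random_parameters \<phi>\<^sub>0 \<pi>\<^sub>2 N F M \<phi>"
    and "F \<noteq> {}" "0 < \<epsilon>"
  shows "measure M {\<omega> \<in> space M. \<bar>ETP f F \<sigma> (\<lambda>j. \<phi> j \<omega>) C / card F - BETP f \<pi>\<^sub>2 F \<sigma> C\<bar> > \<epsilon>}
    \<le> 2 * exp (- (2 * \<epsilon>\<^sup>2) * card F)"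
proof -
  interpret prob_space M using rp by (simp add: random_parameters_def)
  have fin: "finite F" and \<sigma>: "\<And>j. j \<in> F \<Longrightarrow> 0 < \<sigma> j"
    using tp by (auto simp: testing_problem_def finite_subset)
  have indep: "indep_vars (\<lambda>_. borel) \<phi> F" and distr: "\<And>j. j \<in> F \<Longrightarrow> distr M borel (\<phi> j) = \<pi>\<^sub>2"
    using rp by (auto simp: random_parameters_def)
  then have rv: "\<phi> j \<in> borel_measurable M" if "j \<in> F" for j
    using that by (auto simp: indep_vars_def)
  define X where "X = (\<lambda>j \<omega>. reject_prob f (\<phi> j \<omega>) (\<sigma> j) C)"
  have mean: "expectation (X j) = (LINT \<phi>|\<pi>\<^sub>2. reject_prob f \<phi> (\<sigma> j) C)" if "j \<in> F" for j
    unfolding X_def distr[OF that, symmetric]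
    by (subst integral_distr[OF rv[OF that]])
       (auto intro: borel_measurable_reject_prob[OF f \<sigma>[OF that] C])
  interpret Hoeffding_ineq M F X "\<lambda>_. 0" "\<lambda>_. 1" "\<Sum>j\<in>F. expectation (X j)"
  proof unfold_locales
    show "indep_vars (\<lambda>_. borel) X F"
      unfolding X_def
      by (rule indep_vars_compose2[OF indep]) (intro borel_measurable_reject_prob f \<sigma> C)
  qed (auto simp: fin X_def \<sigma> intro!: reject_prob_bounds f C)
  define n where "n = real (card F)"
  have n: "n > 0" using fin \<open>F \<noteq> {}\<close> by (simp add: n_def card_gt_0_iff)
  have eq: "ETP f F \<sigma> (\<lambda>j. \<phi> j \<omega>) C / card F - BETP f \<pi>\<^sub>2 F \<sigma> C
      = ((\<Sum>j\<in>F. X j \<omega>) - (\<Sum>j\<in>F. expectation (X j))) / n" for \<omega>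
    by (simp add: ETP_def BETP_def mean n_def X_def[symmetric] diff_divide_distrib cong: sum.cong)
       (simp add: X_def)
  \<comment> \<open>The strict deviation event for the average lies in the non-strict one for the
    sum, with the threshold scaled by \<open>n\<close>.\<close>
  have "measure M {\<omega> \<in> space M. \<bar>ETP f F \<sigma> (\<lambda>j. \<phi> j \<omega>) C / card F - BETP f \<pi>\<^sub>2 F \<sigma> C\<bar> > \<epsilon>}
      \<le> prob {\<omega> \<in> space M. \<bar>(\<Sum>j\<in>F. X j \<omega>) - (\<Sum>j\<in>F. expectation (X j))\<bar> \<ge> n * \<epsilon>}"
    using n unfolding eq by (intro finite_measure_mono) (auto simp: field_simps)
  also have "\<dots> \<le> 2 * exp (-2 * (n * \<epsilon>)\<^sup>2 / (\<Sum>j\<in>F. (1 - 0)\<^sup>2))"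
    using n \<open>0 < \<epsilon>\<close> by (intro Hoeffding_ineq_abs_ge) (auto simp: n_def)
  \<comment> \<open>The \<open>n\<close> squared interval widths sum to \<open>n\<close>, which
    cancels one of the two factors \<open>n\<close> above.\<close>
  also have "-2 * (n * \<epsilon>)\<^sup>2 / (\<Sum>j\<in>F. (1 - 0)\<^sup>2) = - (2 * \<epsilon>\<^sup>2) * card F"
    using n by (simp add: n_def[symmetric] power2_eq_square)
  finally show ?thesis .
qed

lemma ETP_tends_to_BETP:
  assumes f: "density_family f" and C: "C \<in> sets borel"
    and tp: "\<And>n. testing_problem (N n) (F n) (\<sigma> n)"
    and rp: "\<And>n. random_parameters \<phi>\<^sub>0 \<pi>\<^sub>2 (N n) (F n) (M n) (\<phi> n)"
    and lim: "filterlim (\<lambda>n. card (F n)) at_top sequentially"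
  shows "tends_to_zero_in_prob M
    (\<lambda>n \<omega>. ETP f (F n) (\<sigma> n) (\<lambda>j. \<phi> n j \<omega>) C / real (card (F n)) - BETP f \<pi>\<^sub>2 (F n) (\<sigma> n) C)"
  unfolding tends_to_zero_in_prob_def
proof (intro conjI allI impI)
  fix n
  have "prob_space (M n)" "prob_space.indep_vars (M n) (\<lambda>_. borel) (\<phi> n) (F n)"
    using rp[of n] by (auto simp: random_parameters_def)
  then have "\<phi> n j \<in> borel_measurable (M n)" if "j \<in> F n" for j
    using that by (auto simp: prob_space.indep_vars_def)
  moreover have "(\<lambda>x. reject_prob f x (\<sigma> n j) C) \<in> borel_measurable borel" if "j \<in> F n" for j
    using tp[of n] that by (intro borel_measurable_reject_prob f C) (auto simp: testing_problem_def)
  ultimately have "(\<lambda>\<omega>. reject_prob f (\<phi> n j \<omega>) (\<sigma> n j) C) \<in> borel_measurable (M n)" if "j \<in> F n" for j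
    using that measurable_compose by blast
  then have "(\<lambda>\<omega>. ETP f (F n) (\<sigma> n) (\<lambda>j. \<phi> n j \<omega>) C) \<in> borel_measurable (M n)"
    unfolding ETP_def by (intro borel_measurable_sum)
  then show "(\<lambda>\<omega>. ETP f (F n) (\<sigma> n) (\<lambda>j. \<phi> n j \<omega>) C / real (card (F n))
      - BETP f \<pi>\<^sub>2 (F n) (\<sigma> n) C) \<in> borel_measurable (M n)"
    by simp
next
  fix \<epsilon> :: real assume "0 < \<epsilon>"
  let ?p = "\<lambda>n. measure (M n) {\<omega> \<in> space (M n).
    \<bar>ETP f (F n) (\<sigma> n) (\<lambda>j. \<phi> n j \<omega>) C / real (card (F n)) - BETP f \<pi>\<^sub>2 (F n) (\<sigma> n) C\<bar> > \<epsilon>}"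
  \<comment> \<open>The concentration bound assumes a nonempty \<open>F n\<close>, which the early
    problems of the sequence need not have.\<close>
  have "eventually (\<lambda>n. 1 \<le> card (F n)) sequentially"
    using lim by (simp add: filterlim_at_top)
  then have bound: "eventually (\<lambda>n. ?p n \<le> 2 * exp (- (2 * \<epsilon>\<^sup>2) * card (F n))) sequentially"
    by eventually_elim (intro ETP_concentration[OF f C tp rp], use \<open>0 < \<epsilon>\<close> in auto)
  have "filterlim (\<lambda>n. - (2 * \<epsilon>\<^sup>2) * real (card (F n))) at_bot sequentially"
    using \<open>0 < \<epsilon>\<close>
    by (intro filterlim_tendsto_neg_mult_at_bot[OF tendsto_const]
          filterlim_compose[OF filterlim_real_sequentially lim]) auto
  then have "(\<lambda>n. 2 * exp (- (2 * \<epsilon>\<^sup>2) * real (card (F n)))) \<longlonglongrightarrow> 2 * 0"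
    by (intro tendsto_mult tendsto_const filterlim_compose[OF exp_at_bot])
  then have "(\<lambda>n. 2 * exp (- (2 * \<epsilon>\<^sup>2) * real (card (F n)))) \<longlonglongrightarrow> 0"
    by simp
  from tendsto_sandwich[OF _ bound tendsto_const this] show "?p \<longlonglongrightarrow> 0"
    by simp
qed

section \<open>Sums of rejection probabilities as integrals over the rejection region\<close>

text \<open>Serves the true null hypotheses: with \<open>\<phi>\<close> equal to
  \<open>\<phi>\<^sub>0\<close>, the sum in the integrand is the denominator of the ratio.\<close>

lemma ennreal_sum_reject_prob:
  assumes f: "density_family f" and C[measurable]: "C \<in> sets borel" and "\<And>j. j \<in> A \<Longrightarrow> 0 < \<sigma> j"
  shows "ennreal (\<Sum>j\<in>A. reject_prob f \<phi> (\<sigma> j) C)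
    = (\<integral>\<^sup>+ y. (\<Sum>j\<in>A. ennreal (f y \<phi> (\<sigma> j))) * indicator C y \<partial>lborel)"
proof -
  have "ennreal (\<Sum>j\<in>A. reject_prob f \<phi> (\<sigma> j) C) = (\<Sum>j\<in>A. ennreal (reject_prob f \<phi> (\<sigma> j) C))"
    using assms by (subst sum_ennreal) (auto intro: reject_prob_bounds)
  also have "\<dots> = (\<Sum>j\<in>A. \<integral>\<^sup>+ y. ennreal (f y \<phi> (\<sigma> j)) * indicator C y \<partial>lborel)"
    using assms by (intro sum.cong) (auto intro: ennreal_reject_prob)
  also have "\<dots> = (\<integral>\<^sup>+ y. (\<Sum>j\<in>A. ennreal (f y \<phi> (\<sigma> j)) * indicator C y) \<partial>lborel)"
    using assms borel_measurable_density_family_section[OF f]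
    by (intro nn_integral_sum[symmetric]) (auto intro!: borel_measurable_times_ennreal)
  finally show ?thesis
    by (simp add: sum_distrib_right)
qed

lemma borel_measurable_mixture:
  assumes f: "density_family f" "0 < \<sigma>" and \<pi>: "prob_space \<pi>" "sets \<pi> = sets borel"
  shows "(\<lambda>y. \<integral>\<^sup>+ \<phi>. ennreal (f y \<phi> \<sigma>) \<partial>\<pi>) \<in> borel_measurable borel"
proof -
  interpret prob_space \<pi> by fact
  note [measurable] = borel_measurable_density_family[OF f] and [measurable_cong] = \<pi>(2)
  show ?thesis by measurable
qed

lemma ennreal_integral_reject_prob:
  assumes f: "density_family f" "0 < \<sigma>" and C[measurable]: "C \<in> sets borel"
    and \<pi>: "prob_space \<pi>" "sets \<pi> = sets borel"
  shows "ennreal (LINT \<phi>|\<pi>. reject_prob f \<phi> \<sigma> C)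
    = (\<integral>\<^sup>+ y. (\<integral>\<^sup>+ \<phi>. ennreal (f y \<phi> \<sigma>) \<partial>\<pi>) * indicator C y \<partial>lborel)"
proof -
  interpret prob_space \<pi> by fact
  interpret pair_sigma_finite \<pi> lborel ..
  note [measurable] = borel_measurable_density_family[OF f] borel_measurable_reject_prob[OF f C]
    and [measurable_cong] = \<pi>(2)
  \<comment> \<open>A function with values in \<open>[0,1]\<close> is integrable under a probability
    measure, so the two kinds of integral agree.\<close>
  have "ennreal (LINT \<phi>|\<pi>. reject_prob f \<phi> \<sigma> C) = (\<integral>\<^sup>+ \<phi>. ennreal (reject_prob f \<phi> \<sigma> C) \<partial>\<pi>)"
    using reject_prob_bounds[OF f C]
    by (intro nn_integral_eq_integral[symmetric] integrable_const_bound[where B=1]) auto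
  also have "\<dots> = (\<integral>\<^sup>+ \<phi>. (\<integral>\<^sup>+ y. ennreal (f y \<phi> \<sigma>) * indicator C y \<partial>lborel) \<partial>\<pi>)"
    by (simp add: ennreal_reject_prob[OF f C])
  also have "\<dots> = (\<integral>\<^sup>+ y. (\<integral>\<^sup>+ \<phi>. ennreal (f y \<phi> \<sigma>) * indicator C y \<partial>\<pi>) \<partial>lborel)"
    by (rule Fubini'[symmetric]) measurable
  also have "\<dots> = (\<integral>\<^sup>+ y. (\<integral>\<^sup>+ \<phi>. ennreal (f y \<phi> \<sigma>) \<partial>\<pi>) * indicator C y \<partial>lborel)"
    by (intro nn_integral_cong nn_integral_multc) measurable
  finally show ?thesis .
qed

text \<open>Serves the false null hypotheses: the sum in the integrand is the numerator of the
  ratio.\<close>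

lemma ennreal_sum_integral_reject_prob:
  assumes f: "density_family f" and C[measurable]: "C \<in> sets borel" and "\<And>j. j \<in> A \<Longrightarrow> 0 < \<sigma> j"
    and \<pi>: "prob_space \<pi>" "sets \<pi> = sets borel"
  shows "ennreal (\<Sum>j\<in>A. LINT \<phi>|\<pi>. reject_prob f \<phi> (\<sigma> j) C)
    = (\<integral>\<^sup>+ y. (\<Sum>j\<in>A. \<integral>\<^sup>+ \<phi>. ennreal (f y \<phi> (\<sigma> j)) \<partial>\<pi>) * indicator C y \<partial>lborel)"
proof -
  have "ennreal (\<Sum>j\<in>A. LINT \<phi>|\<pi>. reject_prob f \<phi> (\<sigma> j) C)
      = (\<Sum>j\<in>A. ennreal (LINT \<phi>|\<pi>. reject_prob f \<phi> (\<sigma> j) C))"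
    using assms by (subst sum_ennreal) (auto intro!: Bochner_Integration.integral_nonneg reject_prob_bounds)
  also have "\<dots> = (\<Sum>j\<in>A. \<integral>\<^sup>+ y. (\<integral>\<^sup>+ \<phi>. ennreal (f y \<phi> (\<sigma> j)) \<partial>\<pi>) * indicator C y \<partial>lborel)"
    using assms by (intro sum.cong) (auto intro: ennreal_integral_reject_prob)
  also have "\<dots> = (\<integral>\<^sup>+ y. (\<Sum>j\<in>A. (\<integral>\<^sup>+ \<phi>. ennreal (f y \<phi> (\<sigma> j)) \<partial>\<pi>) * indicator C y) \<partial>lborel)"
    using assms borel_measurable_mixture[OF f _ \<pi>]
    by (intro nn_integral_sum[symmetric]) (auto intro!: borel_measurable_times_ennreal)
  finally show ?thesis
    by (simp add: sum_distrib_right)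
qed

section \<open>Optimality of the ratio region\<close>

text \<open>The function \<open>g - c * h\<close> is nonnegative on \<open>C\<close> and nonpositive
  off \<open>C\<close>, so \<open>C\<close> maximizes its integral. Since \<open>g\<close> may be
  infinite and \<open>ennreal\<close> has no negative values, the argument is written with sums in
  place of differences. Points with \<open>g x = c * h x\<close> may lie on either side.\<close>

lemma neyman_pearson:
  fixes g h :: "'a \<Rightarrow> ennreal"
  assumes [measurable]: "g \<in> borel_measurable M" "h \<in> borel_measurable M" "C \<in> sets M" "C' \<in> sets M"
    and ge: "\<And>x. x \<in> C \<Longrightarrow> c * h x \<le> g x" and le: "\<And>x. x \<notin> C \<Longrightarrow> g x \<le> c * h x"
    and size: "(\<integral>\<^sup>+ x. h x * indicator C' x \<partial>M) \<le> (\<integral>\<^sup>+ x. h x * indicator C x \<partial>M)"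
    and fin: "c < top" "(\<integral>\<^sup>+ x. h x * indicator C x \<partial>M) < top"
  shows "(\<integral>\<^sup>+ x. g x * indicator C' x \<partial>M) \<le> (\<integral>\<^sup>+ x. g x * indicator C x \<partial>M)"
proof -
  let ?G = "\<lambda>A. \<integral>\<^sup>+ x. g x * indicator A x \<partial>M" and ?H = "\<lambda>A. \<integral>\<^sup>+ x. h x * indicator A x \<partial>M"
  have split: "?G A + c * ?H B = (\<integral>\<^sup>+ x. g x * indicator A x + c * (h x * indicator B x) \<partial>M)"
    if [measurable]: "A \<in> sets M" "B \<in> sets M" for A B
    by (simp add: nn_integral_add nn_integral_cmult)
  \<comment> \<open>This holds pointwise: the integrands agree on \<open>C \<inter> C'\<close> and
    off both sets, \<open>ge\<close> settles \<open>C - C'\<close>, and \<open>le\<close> settles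
    \<open>C' - C\<close>.\<close>
  have "?G C' + c * ?H C \<le> ?G C + c * ?H C'"
    unfolding split[OF assms(4,3)] split[OF assms(3,4)]
    using ge le by (intro nn_integral_mono) (auto simp: indicator_def)
  also have "\<dots> \<le> ?G C + c * ?H C"
    using size by (intro add_left_mono mult_left_mono) auto
  finally have "c * ?H C + ?G C' \<le> c * ?H C + ?G C"
    by (simp add: add.commute)
  \<comment> \<open>Cancelling a summand in \<open>ennreal\<close> requires it to be finite.\<close>
  moreover have "c * ?H C < top"
    using fin by (simp add: ennreal_mult_less_top)
  ultimately show ?thesis
    by (auto simp: ennreal_add_left_cancel_le)
qed

text \<open>The level is the region's own \<open>BEFP\<close>, so every real \<open>crit\<close>
  yields a MAP test at the level it attains. A threshold \<open>crit \<ge> 0\<close> is the constant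
  of the Neyman-Pearson comparison; a negative one rejects everywhere.\<close>

lemma MAP_test_ratio_region:
  fixes \<phi>\<^sub>0 crit :: real
  assumes f: "density_family f" and \<pi>: "prob_space \<pi>\<^sub>2" "sets \<pi>\<^sub>2 = sets borel"
    and tp: "testing_problem N F \<sigma>" and card: "1 \<le> card F" "card F \<le> N - 1"
  defines "R \<equiv> ratio_region f \<phi>\<^sub>0 \<pi>\<^sub>2 N F \<sigma> crit"
  shows "MAP_test f \<phi>\<^sub>0 \<pi>\<^sub>2 N F \<sigma> (BEFP f \<phi>\<^sub>0 N F \<sigma> R) R"
proof -
  have \<sigma>: "\<And>j. j \<in> F \<Longrightarrow> 0 < \<sigma> j" "\<And>j. j \<in> {1..N} - F \<Longrightarrow> 0 < \<sigma> j"
    using tp by (auto simp: testing_problem_def)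
  \<comment> \<open>With truncated subtraction, \<open>1 \<le> card F\<close> and
    \<open>card F \<le> N - 1\<close> together give \<open>card F < N\<close>, so neither
    denominator vanishes.\<close>
  have pos: "0 < 1 / real (card F)" "0 < 1 / real (N - card F)"
    using card by auto
  define g where "g = (\<lambda>y. \<Sum>j\<in>F. \<integral>\<^sup>+ \<phi>. ennreal (f y \<phi> (\<sigma> j)) \<partial>\<pi>\<^sub>2)"
  define h where "h = (\<lambda>y. \<Sum>j\<in>{1..N} - F. ennreal (f y \<phi>\<^sub>0 (\<sigma> j)))"
  have g[measurable]: "g \<in> borel_measurable lborel"
    unfolding g_def using borel_measurable_mixture[OF f \<sigma>(1) \<pi>] by simp
  have h[measurable]: "h \<in> borel_measurable lborel"
    unfolding h_def using borel_measurable_density_family_section[OF f \<sigma>(2)]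
    by (auto intro!: borel_measurable_sum)
  have h_top: "h y < top" for y
    by (simp add: h_def)
  have R_eq: "R = {y. ereal crit < enn2ereal (g y / h y)}"
    by (simp add: R_def ratio_region_def g_def h_def)
  have "{y \<in> space borel. ereal crit < enn2ereal (g y / h y)} \<in> sets borel"
    by measurable
  then have R[measurable]: "R \<in> sets borel"
    by (simp add: R_eq)
  \<comment> \<open>The common positive factor cancels, and the remaining nonnegative real sums are
    ordered as their images in \<open>ennreal\<close>. The same is done for \<open>BEFP\<close>
    below.\<close>
  have BETP_le: "BETP f \<pi>\<^sub>2 F \<sigma> A \<le> BETP f \<pi>\<^sub>2 F \<sigma> B \<longleftrightarrow>
      (\<integral>\<^sup>+ y. g y * indicator A y \<partial>lborel) \<le> (\<integral>\<^sup>+ y. g y * indicator B y \<partial>lborel)"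
    if "A \<in> sets borel" "B \<in> sets borel" for A B
    unfolding BETP_def mult_le_cancel_left_pos[OF pos(1)] g_def
    using that by (subst (1 2) ennreal_sum_integral_reject_prob[OF f _ \<sigma>(1) \<pi>, symmetric])
      (auto intro!: ennreal_le_iff[symmetric] sum_nonneg Bochner_Integration.integral_nonneg
        reject_prob_bounds[OF f \<sigma>(1)])
  have BEFP_le: "BEFP f \<phi>\<^sub>0 N F \<sigma> A \<le> BEFP f \<phi>\<^sub>0 N F \<sigma> B \<longleftrightarrow>
      (\<integral>\<^sup>+ y. h y * indicator A y \<partial>lborel) \<le> (\<integral>\<^sup>+ y. h y * indicator B y \<partial>lborel)"
    if "A \<in> sets borel" "B \<in> sets borel" for A B
    unfolding BEFP_def mult_le_cancel_left_pos[OF pos(2)] h_def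
    using that by (subst (1 2) ennreal_sum_reject_prob[OF f _ \<sigma>(2), symmetric])
      (auto intro!: ennreal_le_iff[symmetric] sum_nonneg reject_prob_bounds[OF f \<sigma>(2)])
  \<comment> \<open>The integral is the image of a real number, hence finite.\<close>
  have fin: "(\<integral>\<^sup>+ y. h y * indicator R y \<partial>lborel) < top"
    unfolding h_def by (subst ennreal_sum_reject_prob[OF f R \<sigma>(2), symmetric]) auto
  have "BETP f \<pi>\<^sub>2 F \<sigma> C \<le> BETP f \<pi>\<^sub>2 F \<sigma> R"
    if C[measurable]: "C \<in> sets borel" and size: "BEFP f \<phi>\<^sub>0 N F \<sigma> C \<le> BEFP f \<phi>\<^sub>0 N F \<sigma> R" for C
  proof (cases "0 \<le> crit")
    case True
    \<comment> \<open>A nonnegative threshold embeds into \<open>ennreal\<close>, so the comparison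
      in \<open>ereal\<close> can be made there and the denominator cleared.\<close>
    have "y \<in> R \<longleftrightarrow> ennreal crit < g y / h y" for y
      using True by (simp add: R_eq less_ennreal.rep_eq enn2ereal_ennreal)
    then have R_iff: "y \<in> R \<longleftrightarrow> ennreal crit * h y < g y" for y
      using less_divide_ennreal[OF h_top] by simp
    show ?thesis
      unfolding BETP_le[OF C R]
    proof (rule neyman_pearson[OF g h])
      show "ennreal crit * h y \<le> g y" if "y \<in> R" for y
        using that by (simp add: R_iff)
      show "g y \<le> ennreal crit * h y" if "y \<notin> R" for y
        using that by (simp add: R_iff not_less)
    qed (use R C size[unfolded BEFP_le[OF C R]] fin in simp_all)
  next
    case False
    then have "ereal crit < 0" by simp
    \<comment> \<open>The ratio is never negative, so it always exceeds \<open>crit\<close>; the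
      largest region then has the largest integral of \<open>g\<close>.\<close>
    then have "R = UNIV"
      unfolding R_eq by (auto intro: less_le_trans[OF _ enn2ereal_nonneg])
    then show ?thesis
      unfolding BETP_le[OF C R] by (intro nn_integral_mono) (auto simp: indicator_def)
  qed
  then show ?thesis
    using R by (auto simp: MAP_test_def)
qed

theorem theorem4:
  fixes f :: "real ^ 'T \<Rightarrow> real \<Rightarrow> real \<Rightarrow> real"
    and D :: "real set" and \<phi>\<^sub>0 :: real and \<pi>\<^sub>2 :: "real measure"
  assumes "density_family f"
    and "\<phi>\<^sub>0 \<notin> D"
    and "prob_space \<pi>\<^sub>2" and "sets \<pi>\<^sub>2 = sets borel"
    and "D \<in> sets \<pi>\<^sub>2" and "measure \<pi>\<^sub>2 D = 1"
  shows
    "(\<forall>C \<in> sets borel.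
        \<forall>(M :: nat \<Rightarrow> 'w measure) (N :: nat \<Rightarrow> nat) (F :: nat \<Rightarrow> nat set)
          (\<sigma> :: nat \<Rightarrow> nat \<Rightarrow> real) (\<phi> :: nat \<Rightarrow> nat \<Rightarrow> 'w \<Rightarrow> real).
          (\<forall>n. testing_problem (N n) (F n) (\<sigma> n) \<and>
               random_parameters \<phi>\<^sub>0 \<pi>\<^sub>2 (N n) (F n) (M n) (\<phi> n)) \<and>
          filterlim (\<lambda>n. card (F n)) at_top sequentially \<and>
          filterlim (\<lambda>n. N n - card (F n)) at_top sequentially \<longrightarrow>
          tends_to_zero_in_prob M
            (\<lambda>n \<omega>. ETP f (F n) (\<sigma> n) (\<lambda>j. \<phi> n j \<omega>) C / real (card (F n))
                    - BETP f \<pi>\<^sub>2 (F n) (\<sigma> n) C) \<and>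
          tends_to_zero_in_prob M
            (\<lambda>n \<omega>. EFP f \<phi>\<^sub>0 (N n) (F n) (\<sigma> n) C / real (N n - card (F n))
                    - BEFP f \<phi>\<^sub>0 (N n) (F n) (\<sigma> n) C)) \<and>
     (\<forall>(N :: nat) (F :: nat set) (\<sigma> :: nat \<Rightarrow> real) (\<alpha> :: real) (crit :: real).
        testing_problem N F \<sigma> \<and> 1 \<le> card F \<and> card F \<le> N - 1 \<and> 0 \<le> \<alpha> \<and> \<alpha> \<le> 1 \<and>
        BEFP f \<phi>\<^sub>0 N F \<sigma> (ratio_region f \<phi>\<^sub>0 \<pi>\<^sub>2 N F \<sigma> crit) = \<alpha> \<longrightarrow>
        MAP_test f \<phi>\<^sub>0 \<pi>\<^sub>2 N F \<sigma> \<alpha> (ratio_region f \<phi>\<^sub>0 \<pi>\<^sub>2 N F \<sigma> crit))"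
proof (intro conjI ballI allI impI; (elim conjE)?)
  fix C :: "(real ^ 'T) set" and M :: "nat \<Rightarrow> 'w measure" and N F \<sigma> and \<phi> :: "nat \<Rightarrow> nat \<Rightarrow> 'w \<Rightarrow> real"
  assume "C \<in> sets borel"
    and "\<forall>n. testing_problem (N n) (F n) (\<sigma> n) \<and> random_parameters \<phi>\<^sub>0 \<pi>\<^sub>2 (N n) (F n) (M n) (\<phi> n)"
    and "filterlim (\<lambda>n. card (F n)) at_top sequentially"
  then show "tends_to_zero_in_prob M
      (\<lambda>n \<omega>. ETP f (F n) (\<sigma> n) (\<lambda>j. \<phi> n j \<omega>) C / real (card (F n)) - BETP f \<pi>\<^sub>2 (F n) (\<sigma> n) C)"
    using assms by (intro ETP_tends_to_BETP) auto
next
  \<comment> \<open>The difference is identically \<open>0\<close>, also for those \<open>n\<close>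
    where the denominator is \<open>0\<close> and both quotients are \<open>0\<close> by
    convention.\<close>
  show "tends_to_zero_in_prob M
      (\<lambda>n \<omega>. EFP f \<phi>\<^sub>0 (N n) (F n) (\<sigma> n) C / real (N n - card (F n)) - BEFP f \<phi>\<^sub>0 (N n) (F n) (\<sigma> n) C)"
    for C :: "(real ^ 'T) set" and M :: "nat \<Rightarrow> 'w measure" and N F \<sigma>
    by (simp add: tends_to_zero_in_prob_def EFP_def BEFP_def)
next
  fix N F \<sigma> \<alpha> crit
  assume "testing_problem N F \<sigma>" "1 \<le> card F" "card F \<le> N - 1"
    and "BEFP f \<phi>\<^sub>0 N F \<sigma> (ratio_region f \<phi>\<^sub>0 \<pi>\<^sub>2 N F \<sigma> crit) = \<alpha>"
  then show "MAP_test f \<phi>\<^sub>0 \<pi>\<^sub>2 N F \<sigma> \<alpha> (ratio_region f \<phi>\<^sub>0 \<pi>\<^sub>2 N F \<sigma> crit)"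
    using MAP_test_ratio_region[OF assms(1,3,4)] by blast
qed

end
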